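(* Let $n,T$ be positive integers and $\sigma\in(0,1]$. Let $X_1,\dots,X_T\in\mathbb{R}^n$ be generated by an adaptive sequence of $\sigma$-smooth distributions on the unit Euclidean ball $B=\{x\in\mathbb{R}^n:\|x\|_2\le 1\}$, where the distribution $\mathcal{D}_i$ of $X_i$ is chosen after observing $X_1,\dots,X_{i-1}$ and $\epsilon_1,\dots,\epsilon_{i-1}$, and where moreover each such distribution satisfies $\mathbb{E}_{X_i\sim\mathcal{D}_i}[X_iX_i^\top]=cI$ for some $c\in[0,1/n]$. Then there is an online algorithm that, upon seeing $X_i$ (and the past), immediately chooses a sign $\epsilon_i\in\{-1,+1\}$, such that with probability at least $1-T^{-4}$, for all $t\le T$, $$\Big\|\sum_{i=1}^t \epsilon_i X_i\Big\|_\infty \le O\!\left(\log^2\!\left(\frac{Tn}{\sigma}\right)\right).$$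
   Context: A distribution $\mu$ on $B$ is $\sigma$-smooth if $\mu(A)\le \mathcal{U}(A)/\sigma$ for every measurable $A\subseteq B$, where $\mathcal{U}$ is the uniform distribution on $B$. The $O(\cdot)$ hides an absolute constant. *)

theory Defs
  imports "HOL-Probability.Probability"
begin

text \<open>Vectors in R^n are represented as extensional functions on the index set {..<n}.\<close>

definition vecM :: "nat \<Rightarrow> (nat \<Rightarrow> real) measure" where
  "vecM n = PiM {..<n} (\<lambda>_. borel)"

definition lebM :: "nat \<Rightarrow> (nat \<Rightarrow> real) measure" where
  "lebM n = PiM {..<n} (\<lambda>_. lborel)"

definition unit_ball :: "nat \<Rightarrow> (nat \<Rightarrow> real) set" where
  "unit_ball n = {x \<in> space (vecM n). (\<Sum>i<n. (x i)\<^sup>2) \<le> 1}"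

definition unif_ball :: "nat \<Rightarrow> (nat \<Rightarrow> real) measure" where
  "unif_ball n = uniform_measure (lebM n) (unit_ball n)"

definition smooth_dist :: "nat \<Rightarrow> real \<Rightarrow> (nat \<Rightarrow> real) measure \<Rightarrow> bool" where
  "smooth_dist n \<sigma> \<mu> \<longleftrightarrow>
     sets \<mu> = sets (vecM n) \<and> prob_space \<mu> \<and> emeasure \<mu> (unit_ball n) = 1 \<and>
     (\<forall>A \<in> sets (vecM n). A \<subseteq> unit_ball n \<longrightarrow>
        measure \<mu> A \<le> measure (unif_ball n) A / \<sigma>)"

definition isotropic_dist :: "nat \<Rightarrow> (nat \<Rightarrow> real) measure \<Rightarrow> bool" where
  "isotropic_dist n \<mu> \<longleftrightarrow>
     (\<exists>c. 0 \<le> c \<and> c \<le> 1 / real n \<and>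
        (\<forall>j<n. \<forall>k<n. (\<integral>x. x j * x k \<partial>\<mu>) = (if j = k then c else 0)))"

text \<open>Histories: entry i is the pair (X_(i+1), sign of step i+1), True meaning +1.
  Entries not yet revealed hold a default value.\<close>
definition histM :: "nat \<Rightarrow> (nat \<Rightarrow> (nat \<Rightarrow> real) \<times> bool) measure" where
  "histM n = PiM UNIV (\<lambda>_::nat. vecM n \<Otimes>\<^sub>M count_space (UNIV :: bool set))"

definition hist0 :: "nat \<Rightarrow> nat \<Rightarrow> (nat \<Rightarrow> real) \<times> bool" where
  "hist0 n = (\<lambda>_. (restrict (\<lambda>_. 0) {..<n}, True))"

definition sgnb :: "bool \<Rightarrow> real" where
  "sgnb b = (if b then 1 else -1)"

definition adaptive_adversary ::
  "nat \<Rightarrow> real \<Rightarrow> (nat \<Rightarrow> (nat \<Rightarrow> (nat \<Rightarrow> real) \<times> bool) \<Rightarrow> (nat \<Rightarrow> real) measure) \<Rightarrow> bool" where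
  "adaptive_adversary n \<sigma> D \<longleftrightarrow>
     (\<forall>i. D i \<in> histM n \<rightarrow>\<^sub>M subprob_algebra (vecM n) \<and>
          (\<forall>h \<in> space (histM n). smooth_dist n \<sigma> (D i h) \<and> isotropic_dist n (D i h)))"

text \<open>(Possibly randomized) online algorithm: at step i, given the history h and the new
  vector x = X_(i+1), it outputs the sign +1 with probability P i h x.\<close>
definition online_alg ::
  "nat \<Rightarrow> (nat \<Rightarrow> (nat \<Rightarrow> (nat \<Rightarrow> real) \<times> bool) \<Rightarrow> (nat \<Rightarrow> real) \<Rightarrow> real) \<Rightarrow> bool" where
  "online_alg n P \<longleftrightarrow>
     (\<forall>i. (\<lambda>(h, x). P i h x) \<in> histM n \<Otimes>\<^sub>M vecM n \<rightarrow>\<^sub>M borel \<and>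
          (\<forall>h x. 0 \<le> P i h x \<and> P i h x \<le> 1))"

primrec online_process ::
  "nat \<Rightarrow> (nat \<Rightarrow> (nat \<Rightarrow> (nat \<Rightarrow> real) \<times> bool) \<Rightarrow> (nat \<Rightarrow> real) measure)
   \<Rightarrow> (nat \<Rightarrow> (nat \<Rightarrow> (nat \<Rightarrow> real) \<times> bool) \<Rightarrow> (nat \<Rightarrow> real) \<Rightarrow> real)
   \<Rightarrow> nat \<Rightarrow> (nat \<Rightarrow> (nat \<Rightarrow> real) \<times> bool) measure" where
  "online_process n D P 0 = return (histM n) (hist0 n)"
| "online_process n D P (Suc t) =
     online_process n D P t \<bind> (\<lambda>h. D t h \<bind> (\<lambda>x.
       measure_pmf (bernoulli_pmf (P t h x)) \<bind> (\<lambda>e. return (histM n) (h(t := (x, e))))))"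

end

theory Submission
  imports Defs
begin

text \<open>
  Let \<open>d\<close> be the current signed sum and \<open>L = ln (T n / \<sigma>)\<close>. The algorithm is a self-balancing walk: it
  plays \<open>+1\<close> with probability \<open>(1 - clip (\<langle>d, x\<rangle> / K)) / 2\<close>, where \<open>K\<close> is of order \<open>L\<close>. As long as no
  clipping occurs, isotropy gives every direction \<open>\<theta>\<close> of the unit ball the drift
  \<open>- E[\<langle>d, X\<rangle> \<langle>X, \<theta>\<rangle>] / K = - c \<langle>d, \<theta>\<rangle> / K\<close> against a quadratic variation of at most \<open>c\<close>, so that
  \<open>\<langle>d, \<theta>\<rangle>\<close> behaves like an Ornstein--Uhlenbeck process and \<open>cosh (a \<langle>d, \<theta>\<rangle>)\<close> increases in expectation
  by at most \<open>cosh (4 a\<^sup>2 K)\<close> per step. The potential sums this quantity over the coordinate vectors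
  and averages it over uniform \<open>\<theta>\<close>. The average bounds the exponential moments of \<open>\<langle>d, X\<rangle>\<close> for
  uniform \<open>X\<close>, hence, at the price of a factor \<open>1 / \<sigma>\<close>, for every smooth \<open>X\<close>, however adaptively
  chosen; this makes clipping negligible while the potential is at most \<open>M\<close>. Stopping
  the potential at level \<open>M\<close> turns the drift bound into a bound on the probability that \<open>M\<close> is ever
  exceeded, and below \<open>M\<close> every coordinate is \<open>O(L)\<close>, which is \<open>O(L\<^sup>2)\<close> since \<open>L \<ge> 1/2\<close> for \<open>T \<ge> 2\<close>;
  for \<open>T = 1\<close> the probability bound is vacuous.
\<close>

subsection \<open>One step of the walk in a fixed direction\<close>

lemma exp_neg_le_quadratic:
  fixes v :: real
  assumes "0 \<le> v"
  shows "exp (- v) \<le> 1 - v + v\<^sup>2"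
proof -
  have "exp (- v) \<le> 1 / (1 + v)"
    using exp_ge_add_one_self[of v] assms by (simp add: exp_minus field_simps)
  also have "\<dots> \<le> 1 - v + v\<^sup>2"
  proof -
    have "(1 - v + v\<^sup>2) * (1 + v) = 1 + v ^ 3"
      by (simp add: algebra_simps power2_eq_square power3_eq_cube)
    then show ?thesis
      using assms by (simp add: pos_divide_le_eq)
  qed
  finally show ?thesis .
qed

lemma cosh_le_quadratic:
  fixes v :: real
  assumes "\<bar>v\<bar> \<le> 1"
  shows "cosh v \<le> 1 + v\<^sup>2"
proof -
  have "cosh \<bar>v\<bar> \<le> 1 + \<bar>v\<bar>\<^sup>2"
    using exp_bound[of "\<bar>v\<bar>"] exp_neg_le_quadratic[of "\<bar>v\<bar>"] assms
    by (simp add: cosh_field_def)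
  then show ?thesis by (simp add: abs_if split: if_splits)
qed

text \<open>The true error is cubic, but a quadratic bound suffices: the error is charged to the
  same second-order term as the one from \<open>cosh_le_quadratic\<close>, which is where the factor
  2 in \<open>2 * a\<^sup>2 * u\<^sup>2\<close> of \<open>one_step_cosh_le\<close> comes
  from.\<close>

lemma sinh_minus_self_le:
  fixes v :: real
  assumes "\<bar>v\<bar> \<le> 1"
  shows "\<bar>sinh v - v\<bar> \<le> v\<^sup>2"
proof -
  define w where "w = \<bar>v\<bar>"
  then have w: "0 \<le> w" "w \<le> 1" using assms by auto
  have *: "exp w \<le> 1 + w + w\<^sup>2" "exp (- w) \<le> 1 - w + w\<^sup>2" "1 + w \<le> exp w" "1 - w \<le> exp (- w)"
    using exp_bound[of w] exp_neg_le_quadratic[of w] w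
      exp_ge_add_one_self[of w] exp_ge_add_one_self[of "- w"] by simp_all
  \<comment> \<open>With the two exponentials and the square replaced by free variables, the
    estimate is linear arithmetic.\<close>
  have "\<bar>(x - y) / 2 - w\<bar> \<le> q"
    if "x \<le> 1 + w + q" "y \<le> 1 - w + q" "1 + w \<le> x" "1 - w \<le> y" for x y q :: real
    using that by (simp add: abs_le_iff field_simps)
  from this[OF *] have "\<bar>sinh w - w\<bar> \<le> w\<^sup>2"
    by (simp add: sinh_field_def)
  then show ?thesis by (simp add: w_def abs_if split: if_splits)
qed

lemma abs_sinh_le_cosh: "\<bar>sinh (v :: real)\<bar> \<le> cosh v"
  using sinh_le_cosh_real[of v] sinh_le_cosh_real[of "- v"] by simp

lemma cosh_abs_real: "cosh \<bar>v\<bar> = cosh (v :: real)"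
  by (simp add: abs_if)

lemma exp_abs_le_cosh: "exp \<bar>v\<bar> \<le> 2 * cosh (v :: real)"
  by (simp add: cosh_field_def abs_if)

lemma mult_sinh_nonneg: "0 \<le> (y :: real) * sinh (a * y)" if "0 \<le> a"
  using that by (cases "0 \<le> y") (auto simp: zero_le_mult_iff mult_le_0_iff)

text \<open>Ornstein--Uhlenbeck balance: beyond the radius \<open>4 a K\<close> the restoring drift of the walk
  beats its quadratic variation.\<close>

lemma restoring_drift:
  fixes a K c y :: real
  assumes "0 < a" "0 < K" "1 \<le> 4 * a\<^sup>2 * K" "0 \<le> c" "c \<le> 1" "a \<le> 1/2"
  shows "2 * a\<^sup>2 * c * cosh (a * y) - c * a * y * sinh (a * y) / K \<le> cosh (4 * a\<^sup>2 * K)"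
proof (cases "\<bar>y\<bar> \<le> 4 * a * K")
  case True
  have "2 * a\<^sup>2 * c \<le> 1"
  proof -
    have "a\<^sup>2 \<le> (1/2)\<^sup>2" using assms by (intro power_mono) auto
    moreover have "a\<^sup>2 * c \<le> a\<^sup>2" using assms by (simp add: mult_left_le)
    ultimately show ?thesis by (simp add: power2_eq_square)
  qed
  then have "2 * a\<^sup>2 * c * cosh (a * y) \<le> 1 * cosh (a * y)"
    by (intro mult_right_mono) auto
  also have "\<dots> = cosh \<bar>a * y\<bar>" by (simp add: cosh_abs_real)
  also have "\<dots> \<le> cosh (4 * a\<^sup>2 * K)"
  proof (subst cosh_real_nonneg_le_iff)
    show "\<bar>a * y\<bar> \<le> 4 * a\<^sup>2 * K"
      using mult_left_mono[OF True, of a] assms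
      by (simp add: abs_mult power2_eq_square algebra_simps)
  qed (use assms in auto)
  finally have "2 * a\<^sup>2 * c * cosh (a * y) \<le> cosh (4 * a\<^sup>2 * K)" .
  moreover have "0 \<le> c * a * y * sinh (a * y) / K"
    using mult_sinh_nonneg[of a y] assms
    by (metis divide_nonneg_pos less_le mult.assoc mult_nonneg_nonneg)
  ultimately show ?thesis by linarith
next
  case False
  define z where "z = \<bar>a * y\<bar>"
  have z: "4 * a\<^sup>2 * K \<le> z"
    using mult_left_mono[of "4 * a * K" "\<bar>y\<bar>" a] False assms
    by (simp add: z_def abs_mult power2_eq_square algebra_simps)
  \<comment> \<open>From \<open>1 \<le> 4 * a\<^sup>2 * K\<close> follows \<open>1 \<le> z\<close>,
    so \<open>exp (2 * z)\<close> is at least 3, which says that tanh z is at least 1/2.\<close>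
  have "cosh z \<le> 2 * sinh z"
  proof -
    have "3 \<le> exp (2 * z)"
      using exp_ge_add_one_self[of "2 * z"] z assms by linarith
    then have "3 * exp (- z) \<le> exp (2 * z) * exp (- z)"
      by (intro mult_right_mono) auto
    then have "3 * exp (- z) \<le> exp z" by (simp flip: exp_add)
    then show ?thesis by (simp add: cosh_field_def sinh_field_def field_simps)
  qed
  then have "4 * a\<^sup>2 * K * cosh z \<le> z * (2 * sinh z)"
    using z assms by (intro mult_mono) auto
  moreover have "z * sinh z = a * y * sinh (a * y)"
    by (simp add: z_def abs_if)
  ultimately have "4 * a\<^sup>2 * K * cosh (a * y) \<le> 2 * (a * y * sinh (a * y))"
    by (simp add: z_def cosh_abs_real)
  then have "2 * a\<^sup>2 * cosh (a * y) \<le> a * y * sinh (a * y) / K"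
    using assms by (simp add: field_simps)
  then have "c * (2 * a\<^sup>2 * cosh (a * y)) \<le> c * (a * y * sinh (a * y) / K)"
    using assms by (intro mult_left_mono) auto
  then have "2 * a\<^sup>2 * c * cosh (a * y) - c * a * y * sinh (a * y) / K \<le> 0"
    by (simp add: algebra_simps)
  then show ?thesis using cosh_real_nonneg[of "4 * a\<^sup>2 * K"] by linarith
qed

section \<open>The clipped bias and its error\<close>

definition clip :: "real \<Rightarrow> real" where
  "clip r = max (- 1) (min 1 r)"

text \<open>A majorant of the clipping error. Beyond the threshold the exact error is
  \<open>\<bar>s\<bar> / K - 1\<close>; dropping the \<open>- 1\<close> keeps the exponential tail
  bound simple.\<close>

definition excess :: "real \<Rightarrow> real \<Rightarrow> real" where
  "excess K s = (if K < \<bar>s\<bar> then \<bar>s\<bar> / K else 0)"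

lemma excess_nonneg: "0 < K \<Longrightarrow> 0 \<le> excess K s"
  by (simp add: excess_def)

lemma abs_clip_le_1: "\<bar>clip r\<bar> \<le> 1"
  by (simp add: clip_def)

lemma abs_clip_diff_le: "\<bar>s / K - clip (s / K)\<bar> \<le> excess K s" if "0 < K"
proof (cases "K < \<bar>s\<bar>")
  case True
  then show ?thesis using that by (auto simp: clip_def excess_def abs_if max_def min_def field_simps)
next
  case False
  then have "- 1 \<le> s / K" "s / K \<le> 1" using that by (auto simp: field_simps)
  then show ?thesis by (simp add: clip_def excess_def False)
qed

text \<open>The addition theorems turn the left side into a cosh product minus \<open>r\<close>
  times a sinh product, where \<open>r\<close> is the clipped bias and
  \<open>2 * p - 1 = - r\<close>. The term linear in \<open>s * u\<close> is kept exactly, because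
  isotropy evaluates its expectation; everything else is an error relative to
  \<open>cosh (a * y)\<close>.\<close>

lemma one_step_cosh_le:
  fixes a K s u y :: real
  assumes "0 < a" "a \<le> 1" "0 < K" "\<bar>u\<bar> \<le> 1"
  defines "p \<equiv> (1 - clip (s / K)) / 2"
  shows "p * cosh (a * (y + u)) + (1 - p) * cosh (a * (y - u))
    \<le> cosh (a * y) * (1 + 2 * a\<^sup>2 * u\<^sup>2) - s * u * (a * sinh (a * y) / K)
        + cosh (a * y) * excess K s"
proof -
  define r where "r = clip (s / K)"
  have r: "\<bar>r\<bar> \<le> 1" "\<bar>s / K - r\<bar> \<le> excess K s"
    using abs_clip_le_1 abs_clip_diff_le[OF assms(3)] by (auto simp: r_def)
  have au: "\<bar>a * u\<bar> \<le> 1" using assms by (simp add: abs_mult mult_le_one)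
  have "p * cosh (a * (y + u)) + (1 - p) * cosh (a * (y - u))
      = cosh (a * y) * cosh (a * u) - r * sinh (a * y) * sinh (a * u)"
    by (simp add: p_def r_def distrib_left right_diff_distrib cosh_add cosh_diff field_simps)
  \<comment> \<open>Two replacements, each with its error written out: the clipped bias by
    \<open>s / K\<close>, and \<open>sinh (a * u)\<close> by \<open>a * u\<close>.\<close>
  also have "\<dots> = cosh (a * y) * cosh (a * u)
      - s * u * (a * sinh (a * y) / K)
      + (s / K - r) * (a * u) * sinh (a * y)
      - r * sinh (a * y) * (sinh (a * u) - a * u)"
    using assms by (simp add: field_simps)
  also have "\<dots> \<le> cosh (a * y) * (1 + (a * u)\<^sup>2) - s * u * (a * sinh (a * y) / K)
      + cosh (a * y) * excess K s + cosh (a * y) * (a * u)\<^sup>2"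
  proof -
    have 1: "cosh (a * y) * cosh (a * u) \<le> cosh (a * y) * (1 + (a * u)\<^sup>2)"
      using cosh_le_quadratic[OF au] by (intro mult_left_mono) auto
    have "\<bar>(s / K - r) * (a * u) * sinh (a * y)\<bar> \<le> excess K s * 1 * cosh (a * y)"
      unfolding abs_mult[of _ "sinh (a * y)"] abs_mult[of _ "a * u"]
      using r au abs_sinh_le_cosh[of "a * y"] excess_nonneg[OF assms(3)]
      by (intro mult_mono) auto
    then have 2: "(s / K - r) * (a * u) * sinh (a * y) \<le> cosh (a * y) * excess K s"
      by (simp add: mult.commute)
    have "\<bar>r * sinh (a * y) * (sinh (a * u) - a * u)\<bar> \<le> 1 * cosh (a * y) * (a * u)\<^sup>2"
      unfolding abs_mult[of _ "sinh (a * u) - a * u"] abs_mult[of _ "sinh (a * y)"]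
      using r sinh_minus_self_le[OF au] abs_sinh_le_cosh[of "a * y"]
      by (intro mult_mono) auto
    then have 3: "- (r * sinh (a * y) * (sinh (a * u) - a * u)) \<le> cosh (a * y) * (a * u)\<^sup>2"
      by linarith
    from 1 2 3 show ?thesis by linarith
  qed
  also have "\<dots> = cosh (a * y) * (1 + 2 * a\<^sup>2 * u\<^sup>2) - s * u * (a * sinh (a * y) / K)
        + cosh (a * y) * excess K s"
    by (simp add: power_mult_distrib algebra_simps)
  finally show ?thesis .
qed

subsection \<open>Vectors and smooth distributions\<close>

definition dot :: "nat \<Rightarrow> (nat \<Rightarrow> real) \<Rightarrow> (nat \<Rightarrow> real) \<Rightarrow> real" where
  "dot n x y = (\<Sum>i<n. x i * y i)"

lemma dot_commute: "dot n x y = dot n y x"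
  by (simp add: dot_def mult.commute)

lemma dot_add_scaled: "dot n (\<lambda>j. d j + e * x j) z = dot n d z + e * dot n x z"
  by (simp add: dot_def sum.distrib sum_distrib_left algebra_simps)

lemma dot_unit: "j < n \<Longrightarrow> dot n d (\<lambda>i. if i = j then 1 else 0) = d j"
  by (simp add: dot_def if_distrib cong: if_cong)

lemma abs_dot_le_1:
  assumes "dot n x x \<le> 1" "dot n y y \<le> 1"
  shows "\<bar>dot n x y\<bar> \<le> 1"
proof -
  have "(dot n x y)\<^sup>2 \<le> dot n x x * dot n y y"
    using Cauchy_Schwarz_ineq_sum[of x y "{..<n}"] by (simp add: dot_def power2_eq_square)
  also have "\<dots> \<le> 1 * 1"
    using assms by (intro mult_mono) (auto simp: dot_def intro!: sum_nonneg)
  finally show ?thesis by (simp add: abs_square_le_1)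
qed

lemma unit_ball_eq: "unit_ball n = {x \<in> space (vecM n). dot n x x \<le> 1}"
  by (simp add: unit_ball_def dot_def power2_eq_square)

lemma measurable_coord [measurable]: "j < n \<Longrightarrow> (\<lambda>x. x j) \<in> borel_measurable (vecM n)"
  by (simp add: vecM_def)

lemma measurable_dot [measurable]:
  assumes "\<And>j. j < n \<Longrightarrow> (\<lambda>w. f w j) \<in> borel_measurable M"
    and "\<And>j. j < n \<Longrightarrow> (\<lambda>w. g w j) \<in> borel_measurable M"
  shows "(\<lambda>w. dot n (f w) (g w)) \<in> borel_measurable M"
  unfolding dot_def using assms by (intro borel_measurable_sum borel_measurable_times) auto

lemma unit_ball_sets [measurable]: "unit_ball n \<in> sets (vecM n)"
  unfolding unit_ball_eq by measurable

lemma sets_lebM: "sets (lebM n) = sets (vecM n)"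
  unfolding lebM_def vecM_def by (intro sets_PiM_cong) auto

lemma sets_unif_ball [measurable_cong]: "sets (unif_ball n) = sets (vecM n)"
  by (simp add: unif_ball_def sets_lebM)

lemma ennreal_divide_self_le_1: "(b :: ennreal) / b \<le> 1"
  by (cases "b = 0"; cases "b = top") (auto simp: less_top ennreal_top_divide)

text \<open>No volume computation is needed: in \<open>ennreal\<close> we have \<open>0 / 0 = 0\<close> and \<open>\<infinity> / \<infinity> = 0\<close>, so the
  bound does not depend on the ball having positive finite volume.\<close>

lemma emeasure_unif_ball_le_1: "emeasure (unif_ball n) A \<le> 1"
proof (cases "A \<in> sets (vecM n)")
  case True
  then have *: "emeasure (unif_ball n) A
      = emeasure (lebM n) (unit_ball n \<inter> A) / emeasure (lebM n) (unit_ball n)"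
    unfolding unif_ball_def
    by (subst emeasure_uniform_measure) (auto simp: sets_lebM)
  have "emeasure (lebM n) (unit_ball n \<inter> A) \<le> emeasure (lebM n) (unit_ball n)"
    by (intro emeasure_mono) (auto simp: sets_lebM)
  then show ?thesis
    unfolding *
    by (meson divide_right_mono_ennreal order_trans ennreal_divide_self_le_1)
qed (simp add: emeasure_notin_sets sets_unif_ball)

lemma AE_unif_ball: "AE x in unif_ball n. x \<in> unit_ball n"
  unfolding unif_ball_def by (rule AE_uniform_measureI) (auto simp: sets_lebM)

lemma finite_measure_unif_ball: "finite_measure (unif_ball n)"
  using emeasure_unif_ball_le_1[of n "space (unif_ball n)"]
  by (intro finite_measureI) (auto simp: top_unique)

section \<open>Comparison of smooth laws with the uniform law\<close>

lemma smooth_distD: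
  assumes "smooth_dist n \<sigma> \<mu>"
  shows "prob_space \<mu>" "sets \<mu> = sets (vecM n)" "space \<mu> = space (vecM n)"
    "AE x in \<mu>. x \<in> unit_ball n"
proof -
  show 1: "prob_space \<mu>" and 2: "sets \<mu> = sets (vecM n)"
    using assms by (auto simp: smooth_dist_def)
  show "space \<mu> = space (vecM n)" by (rule sets_eq_imp_space_eq[OF 2])
  interpret prob_space \<mu> by (rule 1)
  have "emeasure \<mu> (unit_ball n) = 1" using assms by (auto simp: smooth_dist_def)
  then show "AE x in \<mu>. x \<in> unit_ball n"
    by (intro AE_prob_1) (simp add: emeasure_eq_measure)
qed

text \<open>The definition bounds only sets inside the ball; since \<open>\<mu>\<close> gives the
  ball full mass, \<open>A\<close> may first be intersected with it.\<close>

lemma smooth_emeasure_le: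
  assumes "smooth_dist n \<sigma> \<mu>" "0 < \<sigma>"
  shows "emeasure \<mu> A \<le> ennreal (1 / \<sigma>) * emeasure (unif_ball n) A"
proof (cases "A \<in> sets (vecM n)")
  case True
  note \<mu> = smooth_distD[OF assms(1)]
  interpret prob_space \<mu> by (rule \<mu>)
  interpret U: finite_measure "unif_ball n" by (rule finite_measure_unif_ball)
  have A: "A \<inter> unit_ball n \<in> sets (vecM n)" using True by auto
  have "emeasure \<mu> A = emeasure \<mu> (A \<inter> unit_ball n)"
    using \<mu> True by (intro emeasure_eq_AE) (auto elim!: eventually_mono)
  also have "\<dots> \<le> ennreal (measure (unif_ball n) (A \<inter> unit_ball n) / \<sigma>)"
    using assms(1) A unfolding emeasure_eq_measure smooth_dist_def
    by (intro ennreal_leI) blast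
  also have "\<dots> = ennreal (1 / \<sigma>) * emeasure (unif_ball n) (A \<inter> unit_ball n)"
    using assms(2) by (simp add: U.emeasure_eq_measure flip: ennreal_mult)
  also have "\<dots> \<le> ennreal (1 / \<sigma>) * emeasure (unif_ball n) A"
    using True by (intro mult_left_mono emeasure_mono) (auto simp: sets_unif_ball)
  finally show ?thesis .
next
  case False
  then show ?thesis using smooth_distD(2)[OF assms(1)] by (simp add: emeasure_notin_sets)
qed

text \<open>The density bound of smoothness enters the argument through this inequality: an estimate
  under the uniform law carries over to every law the adversary may choose.\<close>

lemma smooth_nn_integral_le:
  assumes "smooth_dist n \<sigma> \<mu>" "0 < \<sigma>" "f \<in> borel_measurable (vecM n)"
  shows "(\<integral>\<^sup>+x. f x \<partial>\<mu>) \<le> ennreal (1 / \<sigma>) * (\<integral>\<^sup>+x. f x \<partial>unif_ball n)"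
proof -
  have sets: "sets \<mu> = sets (scale_measure (ennreal (1 / \<sigma>)) (unif_ball n))"
    using smooth_distD(2)[OF assms(1)] by (simp add: sets_unif_ball)
  have "\<mu> \<le> scale_measure (ennreal (1 / \<sigma>)) (unif_ball n)"
    using smooth_emeasure_le[OF assms(1,2)] sets sets_eq_imp_space_eq[OF sets]
    by (simp add: le_measure_iff le_fun_def)
  from nn_integral_mono_measure[OF sets this, of f] show ?thesis
    using assms(3)
    by (simp add: nn_integral_scale_measure measurable_cong_sets[OF sets_unif_ball refl])
qed

lemma measurable_excess [measurable]: "excess K \<in> borel_measurable borel"
  unfolding excess_def by measurable

lemma measurable_clip [measurable]: "clip \<in> borel_measurable borel"
  unfolding clip_def by measurable

lemma measurable_cosh [measurable]: "(cosh :: real \<Rightarrow> real) \<in> borel_measurable borel"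
  by (intro borel_measurable_continuous_onI continuous_intros)

text \<open>Half of the exponent absorbs the linear factor: \<open>a * \<bar>s\<bar> / 2\<close> is
  at most \<open>exp (a * \<bar>s\<bar> / 2)\<close>. This is the full exponential times
  \<open>exp (- (a * \<bar>s\<bar> / 2))\<close>, and \<open>\<bar>s\<bar> > K\<close> makes the
  last factor small.\<close>

lemma excess_le_cosh:
  assumes "0 < a" "0 < K"
  shows "excess K s \<le> 4 / (a * K) * exp (- (a * K / 2)) * cosh (a * s)"
proof (cases "K < \<bar>s\<bar>")
  case True
  have "a * \<bar>s\<bar> / 2 \<le> exp (a * \<bar>s\<bar> / 2)"
    using exp_ge_add_one_self[of "a * \<bar>s\<bar> / 2"] by linarith
  also have "\<dots> = exp (a * \<bar>s\<bar>) * exp (- (a * \<bar>s\<bar> / 2))" by (simp flip: exp_add)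
  also have "\<dots> \<le> 2 * cosh (a * s) * exp (- (a * K / 2))"
    using True assms exp_abs_le_cosh[of "a * s"] by (intro mult_mono) (auto simp: abs_mult)
  finally have "\<bar>s\<bar> \<le> (2 * cosh (a * s) * exp (- (a * K / 2))) * (2 / a)"
    using assms by (simp add: field_simps)
  then have "\<bar>s\<bar> / K \<le> (2 * cosh (a * s) * exp (- (a * K / 2))) * (2 / a) / K"
    using assms by (intro divide_right_mono) auto
  with True show ?thesis by (simp add: excess_def mult_ac)
qed (use assms in \<open>auto simp: excess_def\<close>)

subsection \<open>Drift of the potential\<close>

text \<open>Values in \<open>ennreal\<close> allow exchanging integrals and stopping without
  integrability side conditions.\<close>

definition potential :: "real \<Rightarrow> nat \<Rightarrow> (nat \<Rightarrow> real) \<Rightarrow> ennreal" where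
  "potential a n d = (\<Sum>j<n. ennreal (cosh (a * d j)))
     + (\<integral>\<^sup>+\<theta>. ennreal (cosh (a * dot n d \<theta>)) \<partial>unif_ball n)"

text \<open>The incoming vector takes the place of the direction: after passing to the uniform law,
  the integral of \<open>cosh (a * dot n d x)\<close> is exactly the averaged part of the
  potential.\<close>

lemma nn_integral_excess_le:
  assumes "smooth_dist n \<sigma> \<mu>" "0 < \<sigma>" "0 < a" "0 < K"
  shows "(\<integral>\<^sup>+x. ennreal (excess K (dot n d x)) \<partial>\<mu>)
    \<le> ennreal (4 / (a * K * \<sigma>) * exp (- (a * K / 2))) * potential a n d"
proof -
  let ?q = "4 / (a * K) * exp (- (a * K / 2))"
  have "(\<integral>\<^sup>+x. ennreal (excess K (dot n d x)) \<partial>\<mu>)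
      \<le> (\<integral>\<^sup>+x. ennreal (?q * cosh (a * dot n d x)) \<partial>\<mu>)"
    using assms by (intro nn_integral_mono ennreal_leI excess_le_cosh)
  also have "\<dots> \<le> ennreal (1 / \<sigma>) * (\<integral>\<^sup>+x. ennreal (?q * cosh (a * dot n d x)) \<partial>unif_ball n)"
    using assms by (intro smooth_nn_integral_le) auto
  also have "(\<integral>\<^sup>+x. ennreal (?q * cosh (a * dot n d x)) \<partial>unif_ball n)
      = ennreal ?q * (\<integral>\<^sup>+x. ennreal (cosh (a * dot n d x)) \<partial>unif_ball n)"
  proof -
    have eq: "ennreal (?q * cosh (a * dot n d x)) = ennreal ?q * ennreal (cosh (a * dot n d x))" for x
      by (rule ennreal_mult) (use assms in auto)
    show ?thesis unfolding eq by (rule nn_integral_cmult) measurable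
  qed
  also have "ennreal (1 / \<sigma>) * (ennreal ?q * (\<integral>\<^sup>+x. ennreal (cosh (a * dot n d x)) \<partial>unif_ball n))
      = ennreal (4 / (a * K * \<sigma>) * exp (- (a * K / 2)))
          * (\<integral>\<^sup>+x. ennreal (cosh (a * dot n d x)) \<partial>unif_ball n)"
    unfolding mult.assoc[symmetric] using assms
    by (subst ennreal_mult[symmetric]) (auto simp: field_simps)
  also have "\<dots> \<le> ennreal (4 / (a * K * \<sigma>) * exp (- (a * K / 2))) * potential a n d"
    unfolding potential_def by (intro mult_left_mono) (auto intro: add_increasing)
  finally show ?thesis .
qed

lemma abs_coord_le_1:
  assumes "x \<in> unit_ball n" "j < n"
  shows "\<bar>x j\<bar> \<le> 1"
  using abs_dot_le_1[of n x "\<lambda>i. if i = j then 1 else 0"] assms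
  by (simp add: unit_ball_eq dot_unit)

lemma integrable_coord_mult:
  assumes "smooth_dist n \<sigma> \<mu>" "j < n" "k < n"
  shows "integrable \<mu> (\<lambda>x. x j * x k)"
proof -
  note \<mu> = smooth_distD[OF assms(1)]
  interpret prob_space \<mu> by (rule \<mu>)
  show ?thesis
  proof (rule integrable_const_bound[where B = 1])
    show "AE x in \<mu>. norm (x j * x k) \<le> 1"
      using \<mu>(4) by eventually_elim (use assms abs_coord_le_1 in \<open>auto simp: abs_mult mult_le_one\<close>)
  qed (use assms \<mu>(2) in \<open>simp add: measurable_cong_sets[OF \<mu>(2) refl]\<close>)
qed

text \<open>Bilinear expansion into second moments. It is used with \<open>v = w = \<theta>\<close>
  for the quadratic variation and with \<open>v = d\<close>, \<open>w = \<theta>\<close> for the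
  drift.\<close>

lemma isotropic_integral_dot:
  assumes "smooth_dist n \<sigma> \<mu>"
    and c: "\<And>j k. j < n \<Longrightarrow> k < n \<Longrightarrow> (\<integral>x. x j * x k \<partial>\<mu>) = (if j = k then c else 0)"
  shows "integrable \<mu> (\<lambda>x. dot n v x * dot n w x)"
    and "(\<integral>x. dot n v x * dot n w x \<partial>\<mu>) = c * dot n v w"
proof -
  have eq: "dot n v x * dot n w x = (\<Sum>j<n. \<Sum>k<n. v j * w k * (x j * x k))" for x
    unfolding dot_def sum_product by (simp add: mult_ac)
  have int: "integrable \<mu> (\<lambda>x. v j * w k * (x j * x k))" if "j < n" "k < n" for j k
    using integrable_coord_mult[OF assms(1) that] by simp
  show "integrable \<mu> (\<lambda>x. dot n v x * dot n w x)"
    unfolding eq using int by (intro Bochner_Integration.integrable_sum) auto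
  have "(\<integral>x. dot n v x * dot n w x \<partial>\<mu>) = (\<Sum>j<n. \<integral>x. (\<Sum>k<n. v j * w k * (x j * x k)) \<partial>\<mu>)"
    unfolding eq using int
    by (intro Bochner_Integration.integral_sum Bochner_Integration.integrable_sum) auto
  also have "\<dots> = (\<Sum>j<n. \<Sum>k<n. v j * w k * (\<integral>x. x j * x k \<partial>\<mu>))"
    using int by (intro sum.cong refl) (subst Bochner_Integration.integral_sum, auto)
  also have "\<dots> = (\<Sum>j<n. \<Sum>k<n. if j = k then v j * w k * c else 0)"
    by (intro sum.cong refl) (auto simp: c)
  also have "\<dots> = c * dot n v w"
    by (simp add: dot_def sum_distrib_left mult_ac)
  finally show "(\<integral>x. dot n v x * dot n w x \<partial>\<mu>) = c * dot n v w" .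
qed

text \<open>Integrating \<open>one_step_cosh_le\<close> puts the same \<open>c\<close> in front of
  the quadratic variation and of the restoring drift, so \<open>restoring_drift\<close> balances
  them whatever \<open>c\<close> the adversary picks. Clipping contributes the factor
  \<open>1 + \<eta>\<close>.\<close>

lemma direction_drift:
  assumes smooth: "smooth_dist n \<sigma> \<mu>" and iso: "isotropic_dist n \<mu>" and "0 < n"
    and a: "0 < a" "a \<le> 1/2" "0 < K" "1 \<le> 4 * a\<^sup>2 * K"
    and \<theta>: "dot n \<theta> \<theta> \<le> 1"
    and \<eta>: "0 \<le> \<eta>" "(\<integral>\<^sup>+x. ennreal (excess K (dot n d x)) \<partial>\<mu>) \<le> ennreal \<eta>"
  defines "p \<equiv> \<lambda>x. (1 - clip (dot n d x / K)) / 2"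
  shows "(\<integral>\<^sup>+x. ennreal (p x * cosh (a * (dot n d \<theta> + dot n x \<theta>))
            + (1 - p x) * cosh (a * (dot n d \<theta> - dot n x \<theta>))) \<partial>\<mu>)
     \<le> ennreal (cosh (a * dot n d \<theta>) * (1 + \<eta>) + cosh (4 * a\<^sup>2 * K))"
    (is "(\<integral>\<^sup>+x. ennreal (?g x) \<partial>\<mu>) \<le> _")
proof -
  note \<mu> = smooth_distD[OF smooth]
  interpret prob_space \<mu> by (rule \<mu>)
  have [measurable_cong]: "sets \<mu> = sets (vecM n)" by (rule \<mu>)
  obtain c where c: "0 \<le> c" "c \<le> 1 / real n"
    "\<And>j k. j < n \<Longrightarrow> k < n \<Longrightarrow> (\<integral>x. x j * x k \<partial>\<mu>) = (if j = k then c else 0)"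
    using iso by (auto simp: isotropic_dist_def)
  have "c \<le> 1" using c(2) \<open>0 < n\<close> by (simp add: order_trans)
  define y where "y = dot n d \<theta>"
  \<comment> \<open>The pointwise majorant. Its drift term can be negative, so its expectation is
    computed as a real integral.\<close>
  define h where "h x = cosh (a * y) * (1 + 2 * a\<^sup>2 * (dot n \<theta> x * dot n \<theta> x))
      - dot n d x * dot n \<theta> x * (a * sinh (a * y) / K)
      + cosh (a * y) * excess K (dot n d x)" for x
  have p: "0 \<le> p x" "p x \<le> 1" for x
    using abs_clip_le_1[of "dot n d x / K"] by (auto simp: p_def)
  have "integrable \<mu> (\<lambda>x. excess K (dot n d x))"
    using \<eta>(2) excess_nonneg[OF \<open>0 < K\<close>]
    by (intro integrableI_nonneg) (auto simp: le_less_trans)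
  moreover from this have excess: "(\<integral>x. excess K (dot n d x) \<partial>\<mu>) \<le> \<eta>"
    using \<eta> excess_nonneg[OF \<open>0 < K\<close>]
    by (subst (asm) nn_integral_eq_integral) auto
  moreover note I = isotropic_integral_dot[OF smooth c(3)]
  ultimately have h_int: "integrable \<mu> h"
    and "(\<integral>x. h x \<partial>\<mu>) = cosh (a * y) * (1 + 2 * a\<^sup>2 * (c * dot n \<theta> \<theta>))
      - c * y * (a * sinh (a * y) / K) + cosh (a * y) * (\<integral>x. excess K (dot n d x) \<partial>\<mu>)"
    unfolding h_def by (auto simp: prob_space y_def)
  note this(2)
  also have "\<dots> \<le> cosh (a * y) * (1 + 2 * a\<^sup>2 * c) - c * y * (a * sinh (a * y) / K) + cosh (a * y) * \<eta>"
  proof -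
    have "cosh (a * y) * (1 + 2 * a\<^sup>2 * (c * dot n \<theta> \<theta>)) \<le> cosh (a * y) * (1 + 2 * a\<^sup>2 * c)"
      using c(1) \<theta> by (intro mult_left_mono add_left_mono) (auto simp: mult_left_le)
    moreover have "cosh (a * y) * (\<integral>x. excess K (dot n d x) \<partial>\<mu>) \<le> cosh (a * y) * \<eta>"
      using excess by (intro mult_left_mono) auto
    ultimately show ?thesis by linarith
  qed
  also have "\<dots> \<le> cosh (a * y) * (1 + \<eta>) + cosh (4 * a\<^sup>2 * K)"
    using restoring_drift[OF a(1,3,4) c(1) \<open>c \<le> 1\<close> a(2), of y] by (simp add: algebra_simps)
  finally have h_le: "(\<integral>x. h x \<partial>\<mu>) \<le> cosh (a * y) * (1 + \<eta>) + cosh (4 * a\<^sup>2 * K)" .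
  \<comment> \<open>Almost everywhere only: \<open>\<bar>dot n \<theta> x\<bar> \<le> 1\<close> is
    derived from \<open>x\<close> lying in the ball.\<close>
  have g_le_h: "AE x in \<mu>. ?g x \<le> h x"
    using \<mu>(4)
  proof eventually_elim
    case (elim x)
    then have "\<bar>dot n \<theta> x\<bar> \<le> 1" using \<theta> by (intro abs_dot_le_1) (auto simp: unit_ball_eq)
    from one_step_cosh_le[OF a(1) _ a(3) this, where y = y and s = "dot n d x"] a(2)
    show ?case
      by (simp add: h_def p_def y_def dot_commute[of n x \<theta>] power2_eq_square)
  qed
  have g_nonneg: "0 \<le> ?g x" for x
    using p by (intro add_nonneg_nonneg mult_nonneg_nonneg) auto
  \<comment> \<open>Domination of the nonnegative \<open>?g\<close> makes \<open>h\<close>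
    nonnegative, which allows returning from the real integral to the \<open>ennreal\<close>
    one.\<close>
  have h_nonneg: "AE x in \<mu>. 0 \<le> h x"
    using g_le_h by eventually_elim (rule order_trans[OF g_nonneg])
  have "(\<integral>\<^sup>+x. ennreal (?g x) \<partial>\<mu>) \<le> (\<integral>\<^sup>+x. ennreal (h x) \<partial>\<mu>)"
  proof (rule nn_integral_mono_AE)
    show "AE x in \<mu>. ennreal (?g x) \<le> ennreal (h x)"
      using g_le_h by eventually_elim (rule ennreal_leI)
  qed
  also have "\<dots> = ennreal (\<integral>x. h x \<partial>\<mu>)"
    by (rule nn_integral_eq_integral[OF h_int h_nonneg])
  also have "\<dots> \<le> ennreal (cosh (a * y) * (1 + \<eta>) + cosh (4 * a\<^sup>2 * K))"
    using h_le by (rule ennreal_leI)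
  finally show ?thesis by (simp add: y_def)
qed

lemma measurable_potential [measurable]:
  assumes "\<And>j. j < n \<Longrightarrow> (\<lambda>w. f w j) \<in> borel_measurable M"
  shows "(\<lambda>w. potential a n (f w)) \<in> borel_measurable M"
proof -
  interpret U: finite_measure "unif_ball n" by (rule finite_measure_unif_ball)
  have [measurable]: "(\<lambda>(w, \<theta>). cosh (a * dot n (f w) \<theta>)) \<in> borel_measurable (M \<Otimes>\<^sub>M unif_ball n)"
    unfolding split_beta'
    using measurable_compose[OF measurable_fst assms]
      measurable_compose[OF measurable_snd measurable_coord]
    by measurable
  have "(\<lambda>w. \<integral>\<^sup>+\<theta>. ennreal (cosh (a * dot n (f w) \<theta>)) \<partial>unif_ball n) \<in> borel_measurable M"
    by measurable
  then show ?thesis unfolding potential_def using assms by measurable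
qed

text \<open>\<open>direction_drift\<close> applies to each unit vector and to almost every
  \<open>\<theta>\<close>, with one common \<open>\<eta>\<close>, since the clipping error does not
  depend on the direction. The average has total mass at most 1 and so counts as one further
  direction, hence \<open>n + 1\<close>.\<close>

lemma potential_drift:
  assumes smooth: "smooth_dist n \<sigma> \<mu>" and iso: "isotropic_dist n \<mu>" and "0 < n"
    and a: "0 < a" "a \<le> 1/2" "0 < K" "1 \<le> 4 * a\<^sup>2 * K"
    and \<eta>: "0 \<le> \<eta>" "(\<integral>\<^sup>+x. ennreal (excess K (dot n d x)) \<partial>\<mu>) \<le> ennreal \<eta>"
  defines "p \<equiv> \<lambda>x. (1 - clip (dot n d x / K)) / 2"
  shows "(\<integral>\<^sup>+x. \<integral>\<^sup>+e. potential a n (\<lambda>j. d j + sgnb e * x j) \<partial>bernoulli_pmf (p x) \<partial>\<mu>)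
     \<le> ennreal (1 + \<eta>) * potential a n d + ennreal (real (n + 1) * cosh (4 * a\<^sup>2 * K))"
proof -
  note \<mu> = smooth_distD[OF smooth]
  interpret prob_space \<mu> by (rule \<mu>)
  interpret U: finite_measure "unif_ball n" by (rule finite_measure_unif_ball)
  interpret pair_sigma_finite \<mu> "unif_ball n" ..
  have [measurable_cong]: "sets \<mu> = sets (vecM n)" by (rule \<mu>)
  define B where "B = cosh (4 * a\<^sup>2 * K)"
  have B: "0 \<le> B" by (simp add: B_def)
  define g where "g \<theta> x = p x * cosh (a * (dot n d \<theta> + dot n x \<theta>))
      + (1 - p x) * cosh (a * (dot n d \<theta> - dot n x \<theta>))" for \<theta> x
  define unit where "unit j = (\<lambda>i. if i = j then 1 else 0 :: real)" for j :: nat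
  have p: "0 \<le> p x" "p x \<le> 1" for x
    using abs_clip_le_1[of "dot n d x / K"] by (auto simp: p_def)
  have [measurable]: "p \<in> borel_measurable (vecM n)"
    unfolding p_def by measurable
  have [measurable]: "(\<lambda>(x, \<theta>). ennreal (g \<theta> x)) \<in> borel_measurable (vecM n \<Otimes>\<^sub>M vecM n)"
    unfolding split_beta' g_def
    using measurable_compose[OF measurable_fst measurable_coord]
      measurable_compose[OF measurable_snd measurable_coord]
    by measurable
  have [measurable]: "(\<lambda>x. ennreal (g \<theta> x)) \<in> borel_measurable (vecM n)" for \<theta>
    unfolding g_def by measurable
  have drift: "(\<integral>\<^sup>+x. ennreal (g \<theta> x) \<partial>\<mu>) \<le> ennreal (1 + \<eta>) * ennreal (cosh (a * dot n d \<theta>)) + ennreal B"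
    if "dot n \<theta> \<theta> \<le> 1" for \<theta>
    using direction_drift[OF smooth iso \<open>0 < n\<close> a that \<eta>] \<eta>(1)
    by (simp add: g_def p_def B_def mult.commute flip: ennreal_mult ennreal_plus)
  have two_point: "ennreal (cosh u) * ennreal (p x) + ennreal (cosh v) * ennreal (1 - p x)
      = ennreal (p x * cosh u + (1 - p x) * cosh v)" for u v x
    using p[of x] by (simp add: mult.commute flip: ennreal_mult ennreal_plus)
  have split: "(\<integral>\<^sup>+e. potential a n (\<lambda>j. d j + sgnb e * x j) \<partial>bernoulli_pmf (p x))
      = (\<Sum>j<n. ennreal (g (unit j) x)) + (\<integral>\<^sup>+\<theta>. ennreal (g \<theta> x) \<partial>unif_ball n)"
    if [measurable]: "x \<in> space (vecM n)" for x
  proof -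
    have "(\<integral>\<^sup>+e. potential a n (\<lambda>j. d j + sgnb e * x j) \<partial>bernoulli_pmf (p x))
      = (\<Sum>j<n. ennreal (cosh (a * (d j + x j))) * ennreal (p x)
            + ennreal (cosh (a * (d j - x j))) * ennreal (1 - p x))
        + (\<integral>\<^sup>+\<theta>. ennreal (cosh (a * (dot n d \<theta> + dot n x \<theta>))) * ennreal (p x)
            + ennreal (cosh (a * (dot n d \<theta> - dot n x \<theta>))) * ennreal (1 - p x) \<partial>unif_ball n)"
      using p[of x] unfolding potential_def dot_add_scaled
      by (subst nn_integral_add, measurable, subst nn_integral_multc, measurable,
          subst nn_integral_multc, measurable)
        (simp add: sgnb_def sum.distrib distrib_right sum_distrib_right add_ac del: sum_ennreal)
    also have "\<dots> = (\<Sum>j<n. ennreal (g (unit j) x)) + (\<integral>\<^sup>+\<theta>. ennreal (g \<theta> x) \<partial>unif_ball n)"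
      unfolding two_point g_def unit_def by (simp add: dot_unit)
    finally show ?thesis .
  qed
  have "(\<integral>\<^sup>+x. \<integral>\<^sup>+e. potential a n (\<lambda>j. d j + sgnb e * x j) \<partial>bernoulli_pmf (p x) \<partial>\<mu>)
      = (\<integral>\<^sup>+x. (\<Sum>j<n. ennreal (g (unit j) x)) + (\<integral>\<^sup>+\<theta>. ennreal (g \<theta> x) \<partial>unif_ball n) \<partial>\<mu>)"
    using split \<mu>(3) by (intro nn_integral_cong) auto
  also have "\<dots> = (\<Sum>j<n. \<integral>\<^sup>+x. ennreal (g (unit j) x) \<partial>\<mu>)
      + (\<integral>\<^sup>+x. (\<integral>\<^sup>+\<theta>. ennreal (g \<theta> x) \<partial>unif_ball n) \<partial>\<mu>)"
    by (subst nn_integral_add, measurable, subst nn_integral_sum, measurable)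
  \<comment> \<open>The exchange freezes the direction while the step is averaged, as
    \<open>drift\<close> requires.\<close>
  also have "(\<integral>\<^sup>+x. (\<integral>\<^sup>+\<theta>. ennreal (g \<theta> x) \<partial>unif_ball n) \<partial>\<mu>)
      = (\<integral>\<^sup>+\<theta>. (\<integral>\<^sup>+x. ennreal (g \<theta> x) \<partial>\<mu>) \<partial>unif_ball n)"
    by (rule Fubini'[symmetric]) measurable
  also have "(\<Sum>j<n. \<integral>\<^sup>+x. ennreal (g (unit j) x) \<partial>\<mu>) + \<dots>
      \<le> (\<Sum>j<n. ennreal (1 + \<eta>) * ennreal (cosh (a * d j)) + ennreal B)
        + (\<integral>\<^sup>+\<theta>. ennreal (1 + \<eta>) * ennreal (cosh (a * dot n d \<theta>)) + ennreal B \<partial>unif_ball n)"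
  proof (intro add_mono sum_mono nn_integral_mono_AE)
    fix j assume "j \<in> {..<n}"
    then show "(\<integral>\<^sup>+x. ennreal (g (unit j) x) \<partial>\<mu>) \<le> ennreal (1 + \<eta>) * ennreal (cosh (a * d j)) + ennreal B"
      using drift[of "unit j"] by (simp add: unit_def dot_unit)
  next
    show "AE \<theta> in unif_ball n. (\<integral>\<^sup>+x. ennreal (g \<theta> x) \<partial>\<mu>)
        \<le> ennreal (1 + \<eta>) * ennreal (cosh (a * dot n d \<theta>)) + ennreal B"
      using AE_unif_ball by eventually_elim (intro drift, simp add: unit_ball_eq)
  qed
  also have "\<dots> = ennreal (1 + \<eta>) * potential a n d
      + (of_nat n * ennreal B + ennreal B * emeasure (unif_ball n) (space (unif_ball n)))"
  proof -
    have "(\<integral>\<^sup>+\<theta>. ennreal (1 + \<eta>) * ennreal (cosh (a * dot n d \<theta>)) + ennreal B \<partial>unif_ball n)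
        = ennreal (1 + \<eta>) * (\<integral>\<^sup>+\<theta>. ennreal (cosh (a * dot n d \<theta>)) \<partial>unif_ball n)
          + ennreal B * emeasure (unif_ball n) (space (unif_ball n))"
      by (simp add: nn_integral_add nn_integral_cmult)
    then show ?thesis
      unfolding potential_def
      by (simp add: sum.distrib sum_distrib_left distrib_left add_ac del: sum_ennreal)
  qed
  also have "\<dots> \<le> ennreal (1 + \<eta>) * potential a n d + (of_nat n * ennreal B + ennreal B * 1)"
    by (intro add_left_mono mult_left_mono emeasure_unif_ball_le_1) auto
  also have "of_nat n * ennreal B + ennreal B * 1 = ennreal (real (n + 1) * B)"
    using B by (simp add: ennreal_of_nat_eq_real_of_nat algebra_simps flip: ennreal_mult ennreal_plus)
  finally show ?thesis by (simp add: B_def)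
qed

subsection \<open>The online process\<close>

definition signed_sum :: "nat \<Rightarrow> (nat \<Rightarrow> (nat \<Rightarrow> real) \<times> bool) \<Rightarrow> nat \<Rightarrow> real" where
  "signed_sum t h j = (\<Sum>i<t. sgnb (snd (h i)) * fst (h i) j)"

text \<open>Entry \<open>t\<close> records step \<open>t + 1\<close>, so writing it leaves all sums
  of length at most \<open>t\<close> unchanged.\<close>

lemma signed_sum_upd:
  "s \<le> t \<Longrightarrow> signed_sum s (h(t := z)) = signed_sum s h"
  "signed_sum (Suc t) (h(t := (x, e))) = (\<lambda>j. signed_sum t h j + sgnb e * x j)"
  by (auto simp: signed_sum_def fun_eq_iff intro!: sum.cong)

section \<open>The balancing rule and the one-step kernel\<close>

definition balancing :: "real \<Rightarrow> nat \<Rightarrow> nat \<Rightarrow> (nat \<Rightarrow> (nat \<Rightarrow> real) \<times> bool) \<Rightarrow> (nat \<Rightarrow> real) \<Rightarrow> real" where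
  "balancing K n t h x = (1 - clip (dot n (signed_sum t h) x / K)) / 2"

lemma measurable_sgnb [measurable]: "sgnb \<in> borel_measurable (count_space UNIV)"
  by simp

lemma measurable_hist_entry [measurable]:
  "(\<lambda>h. h i) \<in> histM n \<rightarrow>\<^sub>M vecM n \<Otimes>\<^sub>M count_space UNIV"
  unfolding histM_def by measurable

lemma measurable_signed_sum [measurable]:
  assumes "j < n"
  shows "(\<lambda>h. signed_sum t h j) \<in> borel_measurable (histM n)"
proof -
  have [measurable]: "(\<lambda>h. fst (h i) j) \<in> borel_measurable (histM n)" for i
    using assms by (intro measurable_compose[OF _ measurable_coord[OF assms]]) measurable
  show ?thesis unfolding signed_sum_def by measurable
qed

lemma online_alg_balancing: "online_alg n (balancing K n)"
  unfolding online_alg_def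
proof (intro allI conjI)
  fix t h x
  show "0 \<le> balancing K n t h x" "balancing K n t h x \<le> 1"
    using abs_clip_le_1[of "dot n (signed_sum t h) x / K"] by (auto simp: balancing_def)
  show "(\<lambda>(h, x). balancing K n t h x) \<in> histM n \<Otimes>\<^sub>M vecM n \<rightarrow>\<^sub>M borel"
    unfolding balancing_def split_beta'
    using measurable_compose[OF measurable_fst measurable_signed_sum]
      measurable_compose[OF measurable_snd measurable_coord]
    by measurable
qed

text \<open>On a two-point space the probability of each event is an affine function of
  \<open>p w\<close>.\<close>

lemma measurable_bernoulli_pmf:
  assumes [measurable]: "p \<in> borel_measurable M" and p: "\<And>w. 0 \<le> p w \<and> p w \<le> 1"
  shows "(\<lambda>w. measure_pmf (bernoulli_pmf (p w))) \<in> M \<rightarrow>\<^sub>M subprob_algebra (count_space UNIV)"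
proof (rule measurable_subprob_algebra)
  fix A :: "bool set"
  have "emeasure (measure_pmf (bernoulli_pmf (p w))) A
      = indicator A True * ennreal (p w) + indicator A False * ennreal (1 - p w)" for w
    using p[of w] by (simp flip: nn_integral_indicator)
  then show "(\<lambda>w. emeasure (measure_pmf (bernoulli_pmf (p w))) A) \<in> borel_measurable M"
    by simp
qed (auto simp: measure_pmf.subprob_space_axioms)

lemma measurable_hist_upd [measurable]:
  "(\<lambda>((h, x), e). h(t := (x, e))) \<in> (histM n \<Otimes>\<^sub>M vecM n) \<Otimes>\<^sub>M count_space UNIV \<rightarrow>\<^sub>M histM n"
  unfolding histM_def split_beta'
  by (rule measurable_fun_upd[where J = UNIV]) measurable

text \<open>The transition kernel of the process, named so that measurability in the history is
  established once and \<open>online_process\<close> becomes an iterated bind.\<close>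

definition online_step ::
  "nat \<Rightarrow> (nat \<Rightarrow> (nat \<Rightarrow> (nat \<Rightarrow> real) \<times> bool) \<Rightarrow> (nat \<Rightarrow> real) measure)
   \<Rightarrow> (nat \<Rightarrow> (nat \<Rightarrow> (nat \<Rightarrow> real) \<times> bool) \<Rightarrow> (nat \<Rightarrow> real) \<Rightarrow> real)
   \<Rightarrow> nat \<Rightarrow> (nat \<Rightarrow> (nat \<Rightarrow> real) \<times> bool) \<Rightarrow> (nat \<Rightarrow> (nat \<Rightarrow> real) \<times> bool) measure" where
  "online_step n D P t h = D t h \<bind> (\<lambda>x.
       measure_pmf (bernoulli_pmf (P t h x)) \<bind> (\<lambda>e. return (histM n) (h(t := (x, e)))))"

lemma hist0_space: "hist0 n \<in> space (histM n)"
  by (auto simp: hist0_def histM_def vecM_def space_PiM space_pair_measure split: if_splits)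

context
  fixes n \<sigma> D P
  assumes adversary: "adaptive_adversary n \<sigma> D" and alg: "online_alg n P"
begin

lemma measurable_sign_kernel:
  "(\<lambda>w. measure_pmf (bernoulli_pmf (P t (fst w) (snd w)))
      \<bind> (\<lambda>e. return (histM n) ((fst w)(t := (snd w, e)))))
    \<in> histM n \<Otimes>\<^sub>M vecM n \<rightarrow>\<^sub>M subprob_algebra (histM n)"
proof (rule measurable_bind)
  show "(\<lambda>w. measure_pmf (bernoulli_pmf (P t (fst w) (snd w))))
      \<in> histM n \<Otimes>\<^sub>M vecM n \<rightarrow>\<^sub>M subprob_algebra (count_space UNIV)"
    using alg by (intro measurable_bernoulli_pmf) (auto simp: online_alg_def split_beta')
  show "(\<lambda>w. return (histM n) ((fst (fst w))(t := (snd (fst w), snd w))))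
      \<in> (histM n \<Otimes>\<^sub>M vecM n) \<Otimes>\<^sub>M count_space UNIV \<rightarrow>\<^sub>M subprob_algebra (histM n)"
    using measurable_compose[OF measurable_hist_upd return_measurable]
    by (simp add: split_beta')
qed

lemma measurable_online_step: "online_step n D P t \<in> histM n \<rightarrow>\<^sub>M subprob_algebra (histM n)"
  unfolding online_step_def [abs_def]
proof (rule measurable_bind)
  show "D t \<in> histM n \<rightarrow>\<^sub>M subprob_algebra (vecM n)"
    using adversary by (simp add: adaptive_adversary_def)
qed (rule measurable_sign_kernel)

lemma nn_integral_online_step:
  assumes h: "h \<in> space (histM n)" and f: "f \<in> borel_measurable (histM n)"
  shows "(\<integral>\<^sup>+w. f w \<partial>online_step n D P t h)
    = (\<integral>\<^sup>+x. \<integral>\<^sup>+e. f (h(t := (x, e))) \<partial>bernoulli_pmf (P t h x) \<partial>D t h)"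
proof -
  have smooth: "smooth_dist n \<sigma> (D t h)"
    using adversary h by (auto simp: adaptive_adversary_def)
  have sets: "sets (D t h) = sets (vecM n)" and space: "space (D t h) = space (vecM n)"
    using smooth_distD[OF smooth] by auto
  have upd: "h(t := (x, e)) \<in> space (histM n)" if "x \<in> space (vecM n)" for x e
    using measurable_space[OF measurable_hist_upd, of "((h, x), e)"] h that
    by (simp add: space_pair_measure)
  have "(\<integral>\<^sup>+w. f w \<partial>online_step n D P t h)
      = (\<integral>\<^sup>+x. \<integral>\<^sup>+w. f w \<partial>(measure_pmf (bernoulli_pmf (P t h x))
          \<bind> (\<lambda>e. return (histM n) (h(t := (x, e))))) \<partial>D t h)"
    unfolding online_step_def
  proof (rule nn_integral_bind[OF f])
    show "(\<lambda>x. measure_pmf (bernoulli_pmf (P t h x)) \<bind> (\<lambda>e. return (histM n) (h(t := (x, e)))))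
        \<in> D t h \<rightarrow>\<^sub>M subprob_algebra (histM n)"
      using measurable_compose[OF measurable_Pair1'[OF h] measurable_sign_kernel[of t]]
      by (simp add: measurable_cong_sets[OF sets refl])
  qed
  also have "\<dots> = (\<integral>\<^sup>+x. \<integral>\<^sup>+e. f (h(t := (x, e))) \<partial>bernoulli_pmf (P t h x) \<partial>D t h)"
  proof (rule nn_integral_cong)
    fix x assume "x \<in> space (D t h)"
    then have x: "x \<in> space (vecM n)" by (simp add: space)
    \<comment> \<open>The sign space is discrete, so it is enough that each updated history lies in
      \<open>space (histM n)\<close>.\<close>
    have "(\<lambda>e. return (histM n) (h(t := (x, e))))
        \<in> measure_pmf (bernoulli_pmf (P t h x)) \<rightarrow>\<^sub>M subprob_algebra (histM n)"
      using upd[OF x] by (simp add: space_subprob_algebra subprob_space_return)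
    from nn_integral_bind[OF f this]
    show "(\<integral>\<^sup>+w. f w \<partial>(measure_pmf (bernoulli_pmf (P t h x))
          \<bind> (\<lambda>e. return (histM n) (h(t := (x, e))))))
        = (\<integral>\<^sup>+e. f (h(t := (x, e))) \<partial>bernoulli_pmf (P t h x))"
      using upd[OF x] f by (simp add: nn_integral_return cong: nn_integral_cong)
  qed
  finally show ?thesis .
qed

lemma online_process_Suc: "online_process n D P (Suc t) = online_process n D P t \<bind> online_step n D P t"
  by (simp add: online_step_def [abs_def])


lemma sets_online_process: "sets (online_process n D P t) = sets (histM n)"
proof (induction t)
  case (Suc t)
  then have "space (online_process n D P t) \<noteq> {}"
    using sets_eq_imp_space_eq[OF Suc] hist0_space by auto
  moreover have "sets (online_step n D P t h) = sets (histM n)" if "h \<in> space (online_process n D P t)" for h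
    using measurable_online_step[of t] that sets_eq_imp_space_eq[OF Suc]
    by (auto dest: measurable_space simp: space_subprob_algebra)
  ultimately show ?case
    unfolding online_process_Suc by (intro sets_bind) auto
qed simp

lemma space_online_process: "space (online_process n D P t) = space (histM n)"
  by (rule sets_eq_imp_space_eq[OF sets_online_process])

lemma nn_integral_online_process_Suc:
  assumes "f \<in> borel_measurable (histM n)"
  shows "(\<integral>\<^sup>+h. f h \<partial>online_process n D P (Suc t))
    = (\<integral>\<^sup>+h. \<integral>\<^sup>+x. \<integral>\<^sup>+e. f (h(t := (x, e))) \<partial>bernoulli_pmf (P t h x) \<partial>D t h
        \<partial>online_process n D P t)"
proof -
  have "(\<integral>\<^sup>+h. f h \<partial>online_process n D P (Suc t))
      = (\<integral>\<^sup>+h. \<integral>\<^sup>+w. f w \<partial>online_step n D P t h \<partial>online_process n D P t)"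
    unfolding online_process_Suc
    using assms measurable_online_step[of t]
    by (intro nn_integral_bind) (auto simp: measurable_cong_sets[OF sets_online_process refl])
  also have "\<dots> = (\<integral>\<^sup>+h. \<integral>\<^sup>+x. \<integral>\<^sup>+e. f (h(t := (x, e))) \<partial>bernoulli_pmf (P t h x) \<partial>D t h
        \<partial>online_process n D P t)"
    using assms
    by (intro nn_integral_cong nn_integral_online_step)
      (auto simp: space_online_process)
  finally show ?thesis .
qed

lemma adversary_smooth:
  assumes "h \<in> space (histM n)"
  shows "smooth_dist n \<sigma> (D t h)" "isotropic_dist n (D t h)"
  using adversary assms by (auto simp: adaptive_adversary_def)

lemma prob_space_online_process: "prob_space (online_process n D P t)"
proof (induction t)
  case 0
  then show ?case using hist0_space by (simp add: prob_space_return)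
next
  case (Suc t)
  interpret prob_space "online_process n D P t" by (rule Suc)
  have "(\<integral>\<^sup>+h. 1 \<partial>online_process n D P (Suc t))
      = (\<integral>\<^sup>+h. \<integral>\<^sup>+x. 1 \<partial>D t h \<partial>online_process n D P t)"
    by (subst nn_integral_online_process_Suc) (auto simp: measure_pmf.emeasure_space_1)
  also have "\<dots> = (\<integral>\<^sup>+h. 1 \<partial>online_process n D P t)"
    using smooth_distD(1)[OF adversary_smooth(1)]
    by (intro nn_integral_cong) (simp add: space_online_process prob_space.emeasure_space_1)
  finally show ?case
    by (intro prob_spaceI) (simp add: emeasure_space_1)
qed

end

subsection \<open>The stopped potential\<close>

definition controlled :: "real \<Rightarrow> nat \<Rightarrow> real \<Rightarrow> nat \<Rightarrow> (nat \<Rightarrow> (nat \<Rightarrow> real) \<times> bool) \<Rightarrow> bool" where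
  "controlled a n M t h \<longleftrightarrow> (\<forall>s\<le>t. potential a n (signed_sum s h) \<le> ennreal M)"

text \<open>The potential in units of \<open>M\<close>, frozen at 1 from the first time it exceeds
  \<open>M\<close>. It therefore dominates the indicator of failure.\<close>

definition risk :: "real \<Rightarrow> nat \<Rightarrow> real \<Rightarrow> nat \<Rightarrow> (nat \<Rightarrow> (nat \<Rightarrow> real) \<times> bool) \<Rightarrow> ennreal" where
  "risk a n M t h =
     (if controlled a n M t h then ennreal (1 / M) * potential a n (signed_sum t h) else 1)"

lemma measurable_controlled [measurable]: "Measurable.pred (histM n) (controlled a n M t)"
  unfolding controlled_def by measurable

lemma measurable_risk [measurable]: "risk a n M t \<in> borel_measurable (histM n)"
  unfolding risk_def by measurable

text \<open>At a first exceedance the potential is above \<open>M\<close>, so freezing at 1 only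
  lowers the value.\<close>

lemma risk_le_potential:
  assumes "0 < M" "\<And>s. s < t \<Longrightarrow> potential a n (signed_sum s h) \<le> ennreal M"
  shows "risk a n M t h \<le> ennreal (1 / M) * potential a n (signed_sum t h)"
proof (cases "controlled a n M t h")
  case False
  then have "ennreal M \<le> potential a n (signed_sum t h)"
    using assms(2) by (force simp: controlled_def le_less)
  then have "ennreal (1 / M) * ennreal M \<le> ennreal (1 / M) * potential a n (signed_sum t h)"
    by (rule mult_left_mono) simp
  with False assms(1) show ?thesis by (simp add: risk_def flip: ennreal_mult)
qed (simp add: risk_def)

text \<open>After failure the value 1 persists. Before it, the potential is at most
  \<open>M\<close>, so the expected clipping error is at most \<open>q * M\<close>, and multiplying
  it by the potential costs at most \<open>q * M\<^sup>2 \<le> 1\<close>. Multiplicative growth thus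
  becomes an additive 1.\<close>

lemma risk_drift:
  assumes adversary: "adaptive_adversary n \<sigma> D" and "0 < \<sigma>" "0 < n"
    and a: "0 < a" "a \<le> 1/2" "0 < K" "1 \<le> 4 * a\<^sup>2 * K" and "0 < M"
    and M: "4 / (a * K * \<sigma>) * exp (- (a * K / 2)) * M\<^sup>2 \<le> 1"
    and h: "h \<in> space (histM n)"
  shows "(\<integral>\<^sup>+x. \<integral>\<^sup>+e. risk a n M (Suc t) (h(t := (x, e))) \<partial>bernoulli_pmf (balancing K n t h x) \<partial>D t h)
    \<le> risk a n M t h + ennreal ((1 + real (n + 1) * cosh (4 * a\<^sup>2 * K)) / M)"
proof -
  have smooth: "smooth_dist n \<sigma> (D t h)" and iso: "isotropic_dist n (D t h)"
    using adversary h by (auto simp: adaptive_adversary_def)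
  interpret prob_space "D t h" by (rule smooth_distD[OF smooth])
  show ?thesis
  proof (cases "controlled a n M t h")
    case False
    \<comment> \<open>Failure is permanent: the new entry does not alter the earlier sums.\<close>
    have "\<not> controlled a n M (Suc t) (h(t := z))" for z
    proof
      assume "controlled a n M (Suc t) (h(t := z))"
      then have "potential a n (signed_sum s h) \<le> ennreal M" if "s \<le> t" for s
        using that signed_sum_upd(1)[OF that, of h z] by (metis controlled_def le_Suc_eq)
      with False show False by (simp add: controlled_def)
    qed
    then have "(\<integral>\<^sup>+x. \<integral>\<^sup>+e. risk a n M (Suc t) (h(t := (x, e))) \<partial>bernoulli_pmf (balancing K n t h x) \<partial>D t h) = 1"
      by (simp add: risk_def measure_pmf.emeasure_space_1 emeasure_space_1)
    with False show ?thesis by (simp add: risk_def)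
  next
    case True
    define d where "d = signed_sum t h"
    define \<Phi> where "\<Phi> = potential a n d"
    define q where "q = 4 / (a * K * \<sigma>) * exp (- (a * K / 2))"
    define B where "B = real (n + 1) * cosh (4 * a\<^sup>2 * K)"
    have q: "0 \<le> q" using assms by (simp add: q_def)
    have B: "0 \<le> B" by (simp add: B_def)
    have \<Phi>: "\<Phi> \<le> ennreal M" using True by (simp add: controlled_def \<Phi>_def d_def)
    have "(\<integral>\<^sup>+x. ennreal (excess K (dot n d x)) \<partial>D t h) \<le> ennreal q * \<Phi>"
      unfolding q_def \<Phi>_def using smooth assms by (intro nn_integral_excess_le) auto
    also have "\<dots> \<le> ennreal q * ennreal M" using \<Phi> by (rule mult_left_mono) simp
    also have "\<dots> = ennreal (q * M)" using q \<open>0 < M\<close> by (simp add: ennreal_mult)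
    finally have excess: "(\<integral>\<^sup>+x. ennreal (excess K (dot n d x)) \<partial>D t h) \<le> ennreal (q * M)" .
    have "(\<integral>\<^sup>+x. \<integral>\<^sup>+e. risk a n M (Suc t) (h(t := (x, e))) \<partial>bernoulli_pmf (balancing K n t h x) \<partial>D t h)
        \<le> (\<integral>\<^sup>+x. \<integral>\<^sup>+e. ennreal (1 / M) * potential a n (\<lambda>j. d j + sgnb e * x j)
              \<partial>bernoulli_pmf (balancing K n t h x) \<partial>D t h)"
    proof (intro nn_integral_mono)
      fix x e
      have "risk a n M (Suc t) (h(t := (x, e)))
          \<le> ennreal (1 / M) * potential a n (signed_sum (Suc t) (h(t := (x, e))))"
        using True \<open>0 < M\<close>
        by (intro risk_le_potential) (auto simp: less_Suc_eq_le signed_sum_upd controlled_def)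
      then show "risk a n M (Suc t) (h(t := (x, e))) \<le> ennreal (1 / M) * potential a n (\<lambda>j. d j + sgnb e * x j)"
        by (simp add: signed_sum_upd d_def)
    qed
    also have "\<dots> = (\<integral>\<^sup>+x. ennreal (1 / M) * (\<integral>\<^sup>+e. potential a n (\<lambda>j. d j + sgnb e * x j)
              \<partial>bernoulli_pmf (balancing K n t h x)) \<partial>D t h)"
      by (subst nn_integral_cmult) auto
    also have "\<dots> = ennreal (1 / M) * (\<integral>\<^sup>+x. \<integral>\<^sup>+e. potential a n (\<lambda>j. d j + sgnb e * x j)
              \<partial>bernoulli_pmf (balancing K n t h x) \<partial>D t h)"
    proof (rule nn_integral_cmult)
      have "0 \<le> balancing K n t h x \<and> balancing K n t h x \<le> 1" for x
        using online_alg_balancing[of n K] by (auto simp: online_alg_def)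
      moreover have "(\<lambda>x. balancing K n t h x) \<in> borel_measurable (D t h)"
        unfolding balancing_def measurable_cong_sets[OF smooth_distD(2)[OF smooth] refl]
        by measurable
      moreover have "(\<lambda>x. potential a n (\<lambda>j. d j + e * x j)) \<in> borel_measurable (D t h)" for e
        unfolding measurable_cong_sets[OF smooth_distD(2)[OF smooth] refl]
        by measurable
      ultimately show "(\<lambda>x. \<integral>\<^sup>+e. potential a n (\<lambda>j. d j + sgnb e * x j)
              \<partial>bernoulli_pmf (balancing K n t h x)) \<in> borel_measurable (D t h)"
        by (simp)
    qed
    also have "\<dots> \<le> ennreal (1 / M) * (ennreal (1 + q * M) * \<Phi> + ennreal B)"
      using potential_drift[OF smooth iso \<open>0 < n\<close> a _ excess] q \<open>0 < M\<close>
      by (intro mult_left_mono) (auto simp: balancing_def d_def \<Phi>_def B_def)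
    also have "\<dots> \<le> ennreal (1 / M) * (\<Phi> + ennreal (1 + B))"
    proof (rule mult_left_mono)
      have "ennreal (q * M) * \<Phi> \<le> ennreal (q * M) * ennreal M" using \<Phi> by (rule mult_left_mono) simp
      also have "\<dots> = ennreal (q * M\<^sup>2)"
        using q \<open>0 < M\<close> by (simp add: power2_eq_square mult.assoc flip: ennreal_mult)
      also have "\<dots> \<le> 1" using M by (simp add: q_def)
      finally have "ennreal (q * M) * \<Phi> \<le> 1" .
      moreover have "ennreal (1 + q * M) * \<Phi> = \<Phi> + ennreal (q * M) * \<Phi>"
        using q \<open>0 < M\<close> by (simp add: distrib_right)
      ultimately show "ennreal (1 + q * M) * \<Phi> + ennreal B \<le> \<Phi> + ennreal (1 + B)"
        using B by (simp add: add.assoc add_left_mono add_right_mono)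
    qed simp
    also have "\<dots> = risk a n M t h + ennreal ((1 + B) / M)"
    proof -
      have "ennreal (1 / M) * ennreal (1 + B) = ennreal ((1 + B) / M)"
        using \<open>0 < M\<close> B by (subst ennreal_mult[symmetric]) auto
      with True show ?thesis by (simp add: risk_def \<Phi>_def d_def distrib_left del: ennreal_plus)
    qed
    finally show ?thesis by (simp add: B_def)
  qed
qed

section \<open>Accumulated risk and the probability of failure\<close>

lemma potential_zero_le: "potential a n (signed_sum 0 h) \<le> ennreal (real (n + 1))"
proof -
  have "potential a n (signed_sum 0 h) = of_nat n + emeasure (unif_ball n) (space (unif_ball n))"
    by (simp add: potential_def signed_sum_def dot_def)
  also have "\<dots> \<le> of_nat n + 1" by (intro add_left_mono emeasure_unif_ball_le_1)
  finally show ?thesis by (simp add: ennreal_of_nat_eq_real_of_nat add.commute)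
qed

lemma expected_risk_le:
  assumes adversary: "adaptive_adversary n \<sigma> D" and "0 < \<sigma>" "0 < n"
    and a: "0 < a" "a \<le> 1/2" "0 < K" "1 \<le> 4 * a\<^sup>2 * K" and "0 < M"
    and M: "4 / (a * K * \<sigma>) * exp (- (a * K / 2)) * M\<^sup>2 \<le> 1"
  shows "(\<integral>\<^sup>+h. risk a n M t h \<partial>online_process n D (balancing K n) t)
    \<le> ennreal ((real (n + 1) + real t * (1 + real (n + 1) * cosh (4 * a\<^sup>2 * K))) / M)"
proof (induction t)
  case 0
  have "risk a n M 0 (hist0 n) \<le> ennreal (1 / M) * potential a n (signed_sum 0 (hist0 n))"
    using \<open>0 < M\<close> by (intro risk_le_potential) auto
  also have "\<dots> \<le> ennreal (1 / M) * ennreal (real (n + 1))"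
    by (intro mult_left_mono potential_zero_le) simp
  also have "\<dots> = ennreal (real (n + 1) / M)"
    using \<open>0 < M\<close> by (subst ennreal_mult[symmetric]) auto
  finally show ?case
    using nn_integral_return[OF hist0_space measurable_risk] by simp
next
  case (Suc t)
  let ?b = "(1 + real (n + 1) * cosh (4 * a\<^sup>2 * K)) / M"
  let ?R = "online_process n D (balancing K n) t"
  interpret prob_space ?R
    by (rule prob_space_online_process[OF adversary online_alg_balancing])
  have "(\<integral>\<^sup>+h. risk a n M (Suc t) h \<partial>online_process n D (balancing K n) (Suc t))
      = (\<integral>\<^sup>+h. \<integral>\<^sup>+x. \<integral>\<^sup>+e. risk a n M (Suc t) (h(t := (x, e)))
          \<partial>bernoulli_pmf (balancing K n t h x) \<partial>D t h \<partial>?R)"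
    by (rule nn_integral_online_process_Suc[OF adversary online_alg_balancing measurable_risk])
  also have "\<dots> \<le> (\<integral>\<^sup>+h. risk a n M t h + ennreal ?b \<partial>?R)"
    using risk_drift[OF assms]
    by (intro nn_integral_mono)
      (simp add: space_online_process[OF adversary online_alg_balancing])
  also have "\<dots> = (\<integral>\<^sup>+h. risk a n M t h \<partial>?R) + ennreal ?b"
    by (subst nn_integral_add)
      (auto simp: emeasure_space_1
        measurable_cong_sets[OF sets_online_process[OF adversary online_alg_balancing] refl])
  also have "\<dots> \<le> ennreal ((real (n + 1) + real t * (1 + real (n + 1) * cosh (4 * a\<^sup>2 * K))) / M) + ennreal ?b"
    by (intro add_right_mono Suc)
  also have "\<dots> = ennreal ((real (n + 1) + real (Suc t) * (1 + real (n + 1) * cosh (4 * a\<^sup>2 * K))) / M)"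
    using \<open>0 < M\<close> by (subst ennreal_plus[symmetric]) (auto simp: field_simps)
  finally show ?case .
qed

text \<open>Markov's inequality for the stopped potential. As \<open>controlled\<close> looks at all
  times up to \<open>t\<close>, this acts as a maximal inequality.\<close>

lemma prob_controlled_ge:
  assumes adversary: "adaptive_adversary n \<sigma> D" and "0 < \<sigma>" "0 < n"
    and a: "0 < a" "a \<le> 1/2" "0 < K" "1 \<le> 4 * a\<^sup>2 * K" and "0 < M"
    and M: "4 / (a * K * \<sigma>) * exp (- (a * K / 2)) * M\<^sup>2 \<le> 1"
  shows "1 - (real (n + 1) + real t * (1 + real (n + 1) * cosh (4 * a\<^sup>2 * K))) / M
    \<le> measure (online_process n D (balancing K n) t) {h \<in> space (histM n). controlled a n M t h}"
proof -
  let ?R = "online_process n D (balancing K n) t"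
  let ?\<delta> = "(real (n + 1) + real t * (1 + real (n + 1) * cosh (4 * a\<^sup>2 * K))) / M"
  let ?G = "{h \<in> space (histM n). controlled a n M t h}"
  interpret prob_space ?R
    by (rule prob_space_online_process[OF adversary online_alg_balancing])
  note sets = sets_online_process[OF adversary online_alg_balancing]
  have space: "space ?R = space (histM n)" by (rule sets_eq_imp_space_eq[OF sets])
  have G: "?G \<in> events" unfolding sets by measurable
  have "emeasure ?R (space ?R - ?G) = (\<integral>\<^sup>+h. indicator (space ?R - ?G) h \<partial>?R)"
    using G by (intro nn_integral_indicator[symmetric]) auto
  also have "\<dots> \<le> (\<integral>\<^sup>+h. risk a n M t h \<partial>?R)"
    by (intro nn_integral_mono) (auto simp: risk_def space split: split_indicator)
  also have "\<dots> \<le> ennreal ?\<delta>" by (rule expected_risk_le[OF assms])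
  finally have "prob (space ?R - ?G) \<le> ?\<delta>"
    using \<open>0 < M\<close> by (simp add: emeasure_eq_measure)
  then show ?thesis using prob_compl[OF G] by simp
qed

lemma controlled_imp_coordinate_le:
  assumes "controlled a n M T h" "0 < a" "t \<le> T" "j < n"
  shows "exp (a * \<bar>signed_sum t h j\<bar>) \<le> 2 * M"
proof -
  let ?d = "signed_sum t h"
  have "ennreal (cosh (a * ?d j)) \<le> (\<Sum>j<n. ennreal (cosh (a * ?d j)))"
    using assms(4) by (intro member_le_sum) auto
  also have "\<dots> \<le> potential a n ?d" by (simp add: potential_def)
  also have "\<dots> \<le> ennreal M" using assms by (simp add: controlled_def)
  finally have "cosh (a * ?d j) \<le> M"
    by (metis cosh_real_pos ennreal_le_iff2 not_le)
  then show ?thesis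
    using exp_abs_le_cosh[of "a * ?d j"] assms(2) by (simp add: abs_mult)
qed

subsection \<open>Choice of parameters\<close>

lemma balancing_discrepancy:
  fixes n T :: nat and \<sigma> :: real
  assumes "0 < n" "2 \<le> T" "0 < \<sigma>" "\<sigma> \<le> 1" and adversary: "adaptive_adversary n \<sigma> D"
  defines "L \<equiv> ln (real T * real n / \<sigma>)"
  shows "1 - 1 / real T ^ 4 \<le> measure (online_process n D (balancing (2304 * L) n) T)
    {h \<in> space (histM n). \<forall>t\<in>{1..T}.
       Max ((\<lambda>j. \<bar>\<Sum>i<t. sgnb (snd (h i)) * fst (h i) j\<bar>) ` {..<n}) \<le> 1152 * L\<^sup>2}"
    (is "_ \<le> measure ?R ?S")
proof -
  define N where "N = real T * real n / \<sigma>"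
  have TnN: "real T * real n \<le> N"
    using assms by (simp add: N_def pos_le_divide_eq mult_left_le)
  have TN: "real T \<le> N" and nN: "real n \<le> N"
    using assms by (auto intro!: order_trans[OF _ TnN])
  have N2: "2 \<le> N" using TN assms(2) by linarith
  \<comment> \<open>Apply ln x <= x - 1 at \<open>x = 1 / N\<close> with
    \<open>N \<ge> 2\<close>.\<close>
  have L: "1/2 \<le> L"
  proof -
    have "- L \<le> 1 / N - 1"
      using ln_le_minus_one[of "1 / N"] N2 by (simp add: L_def ln_div flip: N_def)
    moreover have "1 / N \<le> 1 / 2" using N2 by (simp add: field_simps)
    ultimately show ?thesis by linarith
  qed
  have exp_L: "exp (real k * L) = N ^ k" for k
    using N2 by (simp add: L_def exp_of_nat_mult flip: N_def)
  \<comment> \<open>With \<open>N = exp L\<close> these values give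
    \<open>4 * ?a\<^sup>2 * ?K = 9 * L\<close> and \<open>?a * ?K / 2 = 36 * L\<close>. Growth per
    direction and step is then at most \<open>N ^ 9\<close>, and the total over directions and steps
    at most \<open>N ^ 13\<close>; \<open>?M = N ^ 17\<close> leaves \<open>N ^ 4\<close> for
    \<open>T ^ 4\<close>, while \<open>?M\<^sup>2 = N ^ 34\<close> stays below
    \<open>N ^ 36\<close>.\<close>
  let ?K = "2304 * L" and ?a = "1/32 :: real" and ?M = "N ^ 17"
  define Q where "Q = cosh (4 * ?a\<^sup>2 * ?K)"
  let ?B = "1 + real (n + 1) * Q"
  have Q: "Q \<le> N ^ 9"
  proof -
    have "cosh (9 * L) \<le> exp (9 * L)"
      using L by (simp add: cosh_field_def)
    then show ?thesis using exp_L[of 9] by (simp add: Q_def power2_eq_square)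
  qed
  have M: "4 / (?a * ?K * \<sigma>) * exp (- (?a * ?K / 2)) * ?M\<^sup>2 \<le> 1"
  proof -
    have "exp (- (?a * ?K / 2)) = 1 / N ^ 36"
      using exp_L[of 36] by (simp add: exp_minus field_simps)
    \<comment> \<open>Two powers of \<open>N\<close> remain in the denominator; since
      \<open>\<sigma> * N = T * n \<ge> 1\<close>, one of them pays for
      \<open>1 / \<sigma>\<close>.\<close>
    then have "4 / (?a * ?K * \<sigma>) * exp (- (?a * ?K / 2)) * ?M\<^sup>2 = (1 / (18 * L)) * (1 / (\<sigma> * N\<^sup>2))"
      using N2 L assms(3) by (simp add: field_simps flip: power_mult power_add)
    also have "\<dots> \<le> 1 * 1"
    proof (intro mult_mono)
      have "1 \<le> \<sigma> * N"
        using assms mult_mono[of 1 "real T" 1 "real n"] by (simp add: N_def)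
      then have "1 * 1 \<le> (\<sigma> * N) * N" using N2 by (intro mult_mono) auto
      then show "1 / (\<sigma> * N\<^sup>2) \<le> 1" using assms(3) N2
        by (simp add: power2_eq_square divide_le_eq mult.assoc)
      show "1 / (18 * L) \<le> 1" using L by (simp add: divide_le_eq)
    qed (use assms(3) in auto)
    finally show ?thesis by simp
  qed
  have "(real (n + 1) + real T * ?B) / ?M \<le> 1 / real T ^ 4"
  proof -
    have n1: "real (n + 1) \<le> 2 * real n" using assms(1) by simp
    have "real T * real (n + 1) \<le> 2 * N"
      using mult_left_mono[OF n1, of "real T"] TnN by simp
    then have TnQ: "(real T * real (n + 1)) * Q \<le> (2 * N) * N ^ 9"
      by (rule mult_mono[OF _ Q]) (use N2 in \<open>auto simp: Q_def\<close>)
    have "real (n + 1) + real T * ?B = real (n + 1) + real T + (real T * real (n + 1)) * Q"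
      by (simp only: distrib_left mult.assoc mult_1_right add.assoc)
    also have "\<dots> \<le> 2 * N + N + (2 * N) * N ^ 9"
      using n1 nN by (intro add_mono TN TnQ) linarith
    also have "\<dots> = 3 * N + 2 * (N ^ 9 * N)" by simp
    also have "\<dots> \<le> 8 * (N ^ 9 * N)"
    proof -
      have "1 * N \<le> N ^ 9 * N"
        using N2 by (intro mult_right_mono one_le_power) auto
      then show ?thesis using N2 by linarith
    qed
    \<comment> \<open>Here \<open>8 = 2 ^ 3\<close> and \<open>2 \<le> N\<close>.\<close>
    also have "\<dots> \<le> N ^ 3 * (N ^ 9 * N)"
      using power_mono[OF N2, of 3] N2 by (intro mult_right_mono) auto
    also have "\<dots> = N ^ 13"
      by (simp flip: power_Suc2 power_add)
    finally have "(real (n + 1) + real T * ?B) * real T ^ 4 \<le> N ^ 13 * N ^ 4"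
      using TN N2 by (intro mult_mono power_mono) auto
    then show ?thesis
      using N2 assms(2) by (simp add: field_simps flip: power_add)
  qed
  then have "1 - 1 / real T ^ 4 \<le> 1 - (real (n + 1) + real T * ?B) / ?M" by simp
  also have "\<dots> \<le> measure ?R {h \<in> space (histM n). controlled ?a n ?M T h}"
    using prob_controlled_ge[OF adversary assms(3,1), of ?a ?K ?M T] M L N2
    by (simp add: Q_def power2_eq_square)
  also have "\<dots> \<le> measure ?R ?S"
  proof -
    interpret prob_space ?R
      by (rule prob_space_online_process[OF adversary online_alg_balancing])
    \<comment> \<open>The maximum is over a nonempty index set because \<open>0 < n\<close>, so it
      can be read coordinatewise.\<close>
    have S: "?S = {h \<in> space (histM n). \<forall>t\<in>{1..T}. \<forall>j\<in>{..<n}. \<bar>signed_sum t h j\<bar> \<le> 1152 * L\<^sup>2}"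
      using assms(1) by (subst Max_le_iff) (auto simp: signed_sum_def)
    show ?thesis
    proof (rule finite_measure_mono)
      show "?S \<in> events"
        unfolding S sets_online_process[OF adversary online_alg_balancing] by measurable
      show "{h \<in> space (histM n). controlled ?a n ?M T h} \<subseteq> ?S"
        unfolding S
      proof safe
        fix h t j
        assume "controlled ?a n ?M T h" "t \<in> {1..T}" "j < n"
        then have "exp (?a * \<bar>signed_sum t h j\<bar>) \<le> 2 * ?M"
          by (intro controlled_imp_coordinate_le) auto
        \<comment> \<open>One more power of \<open>N\<close> absorbs the factor 2; the exponent 18
          and \<open>?a = 1/32\<close> then yield \<open>576 = 32 * 18\<close>.\<close>
        also have "\<dots> \<le> N * N ^ 17" using N2 by (intro mult_right_mono) auto
        also have "\<dots> = exp (18 * L)" using exp_L[of 18] by (simp flip: power_Suc)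
        finally have "\<bar>signed_sum t h j\<bar> \<le> 576 * L" by simp
        \<comment> \<open>Since \<open>1/2 \<le> L\<close>, the linear bound is at most twice as
          large with \<open>L\<^sup>2\<close> in place of \<open>L\<close>.\<close>
        also have "\<dots> \<le> 1152 * L\<^sup>2"
          using L mult_right_mono[OF L, of L] by (simp add: power2_eq_square)
        finally show "\<bar>signed_sum t h j\<bar> \<le> 1152 * L\<^sup>2" .
      qed
    qed
  qed
  finally show ?thesis .
qed

theorem mainTheorem4:
  shows "\<exists>C::real. \<forall>(n::nat) (T::nat) (\<sigma>::real).
     0 < n \<longrightarrow> 0 < T \<longrightarrow> 0 < \<sigma> \<longrightarrow> \<sigma> \<le> 1 \<longrightarrow>
     (\<exists>P. online_alg n P \<and>
        (\<forall>D. adaptive_adversary n \<sigma> D \<longrightarrow>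
           measure (online_process n D P T)
             {h \<in> space (histM n). \<forall>t\<in>{1..T}.
                Max ((\<lambda>j. \<bar>\<Sum>i<t. sgnb (snd (h i)) * fst (h i) j\<bar>) ` {..<n})
                  \<le> C * (ln (real T * real n / \<sigma>))\<^sup>2}
           \<ge> 1 - 1 / real T ^ 4))"
proof (intro exI[of _ 1152] allI impI)
  fix n T :: nat and \<sigma> :: real
  assume *: "0 < n" "0 < T" "0 < \<sigma>" "\<sigma> \<le> 1"
  show "\<exists>P. online_alg n P \<and>
        (\<forall>D. adaptive_adversary n \<sigma> D \<longrightarrow>
           measure (online_process n D P T)
             {h \<in> space (histM n). \<forall>t\<in>{1..T}.
                Max ((\<lambda>j. \<bar>\<Sum>i<t. sgnb (snd (h i)) * fst (h i) j\<bar>) ` {..<n})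
                  \<le> 1152 * (ln (real T * real n / \<sigma>))\<^sup>2}
           \<ge> 1 - 1 / real T ^ 4)"
  proof (intro exI conjI allI impI)
    show "online_alg n (balancing (2304 * ln (real T * real n / \<sigma>)) n)"
      by (rule online_alg_balancing)
    fix D assume "adaptive_adversary n \<sigma> D"
    then show "1 - 1 / real T ^ 4
      \<le> measure (online_process n D (balancing (2304 * ln (real T * real n / \<sigma>)) n) T)
             {h \<in> space (histM n). \<forall>t\<in>{1..T}.
                Max ((\<lambda>j. \<bar>\<Sum>i<t. sgnb (snd (h i)) * fst (h i) j\<bar>) ` {..<n})
                  \<le> 1152 * (ln (real T * real n / \<sigma>))\<^sup>2}"
      using balancing_discrepancy[of n T \<sigma> D] *
      by (cases "T = 1") (auto simp: measure_nonneg)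
  qed
qed

end
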